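(* Assume an EC-derivation $\pi$ from $\psi=\phi\wedge\tilde l_1\wedge\dots\wedge\tilde l_k$, where $\phi$ is a conjunction of xor-clauses in 3-xor normal form and $\tilde l_1,\dots,\tilde l_k$ are xor-assumption literals. There is an extension $\pi'$ of $\pi$ where an xor-clause $(y\equiv p\oplus p_1'\oplus\dots\oplus p_{n-1}')$ is derived using the rule $\oplus$-Imply on the xor-clauses $\{(x_1\oplus x_2\equiv p_1\oplus p_1'),\ \dots,\ (x_{n-1}\oplus x_n\equiv p_{n-1}\oplus p_{n-1}'),\ (x_1\oplus x_n\oplus y\equiv p_n)\}$ if and only if there is an xor-cycle $\mathrm{XC}(\langle x_1,\dots,x_n\rangle,\langle y_1,\dots,y_{n-1},y\rangle,p)\subseteq\phi$, where $p=p_1\oplus\dots\oplus p_n$, such that for each $y_i\in\{y_1,\dots,y_{n-1}\}$ it holds that $\psi\vdash_{\mathrm{ec}}(y_i\equiv p_i')$.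
   Context: **Xor-clauses.** An xor-clause is written as an equation $z_1\oplus\dots\oplus z_k\equiv q$ over propositional variables with $q\in\{\bot,\top\}$ ($\oplus$ is exclusive or, $\bot$ is false, $\top$ is true); it is implicitly assumed to be in normal form, so that each variable occurs at most once in it. The literal $x$ is identified with $(x\equiv\top)$ and $\neg x$ with $(x\equiv\bot)$; $\bot$ as a clause denotes the empty, unsatisfiable xor-clause. Xor-assumption literals are literals $x$ or $\neg x$ with $x$ a variable of $\phi$. The symbols $x_i,y_i,y$ denote variables and $p,p_i,p_i'$ denote constants in $\{\bot,\top\}$. **3-xor normal form.** A conjunction of xor-clauses is in 3-xor normal form if (i) every xor-clause in it has exactly three variables, and (ii) each pair of xor-clauses in it shares at most one variable. **The system EC.** Its inference rules, written in equation form, are as follows ($x,y,z,x_i$ are variables and $a,b,c_i,d$ are constants in $\{\bot,\top\}$): - Conflict: from $(x\equiv\top)$ and $(x\equiv\bot)$ infer $\bot$. - $\oplus$-Unit$^2$: from $(x\equiv a)$ and $(x\oplus y\equiv b)$ infer $(y\equiv a\oplus b)$. - $\oplus$-Unit$^3$: from $(x\equiv a)$ and $(x\oplus y\oplus z\equiv b)$ infer $(y\oplus z\equiv a\oplus b)$. - $\oplus$-Imply: from $(x_1\oplus x_2\equiv c_1),\dots,(x_{n-1}\oplus x_n\equiv c_{n-1})$ and $(x_1\oplus x_n\oplus y\equiv d)$ infer $(y\equiv c_1\oplus\dots\oplus c_{n-1}\oplus d)$. - $\oplus$-Conflict: from $(x_1\oplus x_2\equiv c_1),\dots,(x_{n-1}\oplus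 x_n\equiv c_{n-1})$ and $(x_n\oplus x_1\equiv c_n)$ infer $\bot$, provided that $c_1\oplus\dots\oplus c_n=\top$. An EC-derivation from a conjunction $\psi$ of xor-clauses is a sequence of xor-clauses each of which is in $\psi$ or is derived from earlier ones in the sequence by one of these rules. An extension of a derivation is a derivation that continues it with further steps. $\psi\vdash_{\mathrm{ec}}D$ means that there is an EC-derivation from $\psi$ in which $D$ occurs. **Xor-cycle.** An xor-cycle is an xor-clause conjunction of the form $(x_1\oplus x_2\oplus y_1\equiv p_1)\wedge\dots\wedge(x_{n-1}\oplus x_n\oplus y_{n-1}\equiv p_{n-1})\wedge(x_1\oplus x_n\oplus y_n\equiv p_n)$, abbreviated $\mathrm{XC}(\langle x_1,\dots,x_n\rangle,\langle y_1,\dots,y_n\rangle,p)$ where $p=p_1\oplus\dots\oplus p_n$. The variables $x_1,\dots,x_n$ are its inner variables and $y_1,\dots,y_n$ its outer variables. In the claim, the last outer variable $y_n$ is $y$, and the constants $p_1,\dots,p_n$ of the cycle are the ones appearing in the premises of $\oplus$-Imply. $\mathrm{XC}(\dots)\subseteq\phi$ means that all its xor-clauses are in $\phi$. *)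

theory Defs
  imports Main "HOL-Library.Sublist"
begin

abbreviation bxor :: "bool \<Rightarrow> bool \<Rightarrow> bool" (infixl "\<oplus>" 65) where
  "p \<oplus> q \<equiv> p \<noteq> q"

(* bigxor c m is c 1 \<oplus> ... \<oplus> c m; indices start at 1 *)
primrec bigxor :: "(nat \<Rightarrow> bool) \<Rightarrow> nat \<Rightarrow> bool" where
  "bigxor c 0 = False"
| "bigxor c (Suc m) = (bigxor c m \<oplus> c (Suc m))"

(* ({z1, ..., zk}, q) with pairwise distinct zi stands for z1 \<oplus> ... \<oplus> zk \<equiv> q in normal form.
   Wherever such a set is written out below, distinctness of the listed variables is required
   explicitly, since otherwise the set would silently merge repeated variables. *)
type_synonym 'v xclause = "'v set \<times> bool"

definition vars :: "'v xclause set \<Rightarrow> 'v set" where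
  "vars \<phi> = (\<Union>C\<in>\<phi>. fst C)"

definition three_xor_nf :: "'v xclause set \<Rightarrow> bool" where
  "three_xor_nf \<phi> \<longleftrightarrow>
     (\<forall>C\<in>\<phi>. card (fst C) = 3) \<and>
     (\<forall>C\<in>\<phi>. \<forall>D\<in>\<phi>. C \<noteq> D \<longrightarrow> card (fst C \<inter> fst D) \<le> 1)"

definition xor_assumptions :: "'v xclause set \<Rightarrow> 'v xclause set" where
  "xor_assumptions \<phi> = {({x}, q) | x q. x \<in> vars \<phi>}"

(* the binary xor-clauses x 1 \<oplus> x 2 \<equiv> c 1, ..., x (n-1) \<oplus> x n \<equiv> c (n-1) *)
definition chain :: "nat \<Rightarrow> (nat \<Rightarrow> 'v) \<Rightarrow> (nat \<Rightarrow> bool) \<Rightarrow> 'v xclause set" where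
  "chain n x c = {({x i, x (i + 1)}, c i) | i. 1 \<le> i \<and> i < n}"

definition imply_inst ::
  "nat \<Rightarrow> (nat \<Rightarrow> 'v) \<Rightarrow> (nat \<Rightarrow> bool) \<Rightarrow> 'v \<Rightarrow> bool \<Rightarrow> 'v xclause set \<Rightarrow> 'v xclause \<Rightarrow> bool" where
  "imply_inst n x c y d P C \<longleftrightarrow>
     n \<ge> 2 \<and> (\<forall>i. 1 \<le> i \<and> i < n \<longrightarrow> x i \<noteq> x (i + 1)) \<and> distinct [x 1, x n, y] \<and>
     P = chain n x c \<union> {({x 1, x n, y}, d)} \<and>
     C = ({y}, bigxor c (n - 1) \<oplus> d)"

inductive ec_rule :: "'v xclause set \<Rightarrow> 'v xclause \<Rightarrow> bool" where
  Conflict: "ec_rule {({x}, True), ({x}, False)} ({}, True)"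
| Unit2: "distinct [x, y] \<Longrightarrow> ec_rule {({x}, a), ({x, y}, b)} ({y}, a \<oplus> b)"
| Unit3: "distinct [x, y, z] \<Longrightarrow> ec_rule {({x}, a), ({x, y, z}, b)} ({y, z}, a \<oplus> b)"
| Imply: "imply_inst n x c y d P C \<Longrightarrow> ec_rule P C"
| Xor_Conflict: "\<lbrakk> n \<ge> 2; \<forall>i. 1 \<le> i \<and> i < n \<longrightarrow> x i \<noteq> x (i + 1); x n \<noteq> x 1; bigxor c n \<rbrakk>
    \<Longrightarrow> ec_rule (chain n x c \<union> {({x n, x 1}, c n)}) ({}, True)"

definition ec_derivation :: "'v xclause set \<Rightarrow> 'v xclause list \<Rightarrow> bool" where
  "ec_derivation \<psi> \<pi> \<longleftrightarrow>
     (\<forall>j < length \<pi>. \<pi> ! j \<in> \<psi> \<or> (\<exists>P \<subseteq> set (take j \<pi>). ec_rule P (\<pi> ! j)))"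

definition ec_derives :: "'v xclause set \<Rightarrow> 'v xclause \<Rightarrow> bool" (infix "\<turnstile>ec" 50) where
  "\<psi> \<turnstile>ec D \<longleftrightarrow> (\<exists>\<pi>. ec_derivation \<psi> \<pi> \<and> D \<in> set \<pi>)"

definition derived_by_imply ::
  "'v xclause list \<Rightarrow> nat \<Rightarrow> (nat \<Rightarrow> 'v) \<Rightarrow> (nat \<Rightarrow> bool) \<Rightarrow> 'v \<Rightarrow> bool \<Rightarrow> 'v xclause \<Rightarrow> bool" where
  "derived_by_imply \<pi> n x c y d C \<longleftrightarrow>
     (\<exists>j < length \<pi>. \<exists>P \<subseteq> set (take j \<pi>). \<pi> ! j = C \<and> imply_inst n x c y d P C)"

(* xor_cycle n x ys ps p X: X is the set of clauses of an XC(<x 1, ..., x n>, <ys 1, ..., ys n>, p)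
   whose i-th clause has right-hand side ps i. Apart from the normal form of the individual
   clauses, no distinctness of inner or outer variables is imposed. *)
definition xor_cycle ::
  "nat \<Rightarrow> (nat \<Rightarrow> 'v) \<Rightarrow> (nat \<Rightarrow> 'v) \<Rightarrow> (nat \<Rightarrow> bool) \<Rightarrow> bool \<Rightarrow> 'v xclause set \<Rightarrow> bool" where
  "xor_cycle n x ys ps p X \<longleftrightarrow>
     n \<ge> 2 \<and> (\<forall>i. 1 \<le> i \<and> i < n \<longrightarrow> distinct [x i, x (i + 1), ys i]) \<and>
     distinct [x 1, x n, ys n] \<and>
     X = {({x i, x (i + 1), ys i}, ps i) | i. 1 \<le> i \<and> i < n} \<union> {({x 1, x n, ys n}, ps n)} \<and>
     p = bigxor ps n"

end

(* The rules of EC only produce clauses with at most two variables, and only Unit3 produces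
   binary ones. So the derivable ternary clauses are those of \<phi>, and a binary clause
   u + v = q is derivable iff some u + v + w = b in \<phi> has w = a derivable with q = b + a.
   Applied to each premise of an Imply step, this is exactly the xor-cycle. *)
theory Submission
  imports Defs
begin

section \<open>Concatenating and extending EC-derivations\<close>

lemma ec_derivation_append:
  assumes "ec_derivation \<psi> \<pi>1" "ec_derivation \<psi> \<pi>2"
  shows "ec_derivation \<psi> (\<pi>1 @ \<pi>2)"
  unfolding ec_derivation_def
proof (intro allI impI)
  fix j assume j: "j < length (\<pi>1 @ \<pi>2)"
  show "(\<pi>1 @ \<pi>2) ! j \<in> \<psi> \<or>
    (\<exists>P \<subseteq> set (take j (\<pi>1 @ \<pi>2)). ec_rule P ((\<pi>1 @ \<pi>2) ! j))"
  proof (cases "j < length \<pi>1")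
    case True
    then show ?thesis using assms(1) by (simp add: ec_derivation_def nth_append)
  next
    case False
    \<comment> \<open>Entries of the second derivation keep their justification: their old
      predecessors stay in front of them, now preceded by all of \<open>\<pi>1\<close> as
      well.\<close>
    define k where "k = j - length \<pi>1"
    have "k < length \<pi>2" "(\<pi>1 @ \<pi>2) ! j = \<pi>2 ! k"
      "set (take k \<pi>2) \<subseteq> set (take j (\<pi>1 @ \<pi>2))"
      using j False by (auto simp: k_def nth_append)
    then show ?thesis using assms(2) unfolding ec_derivation_def by (metis subset_trans)
  qed
qed

lemma ec_derivation_snoc:
  assumes "ec_derivation \<psi> \<pi>" "D \<in> \<psi> \<or> (\<exists>P \<subseteq> set \<pi>. ec_rule P D)"
  shows "ec_derivation \<psi> (\<pi> @ [D])"
  using assms by (auto simp: ec_derivation_def nth_append less_Suc_eq)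

text \<open>Each clause of \<open>A\<close> may come from a derivation of its own. Appending these
  one after another to \<open>\<pi>\<close> makes all of them available at once as premises of a
  further step; the finiteness of \<open>A\<close> bounds this process.\<close>

lemma ec_derives_extension:
  assumes "finite A" "ec_derivation \<psi> \<pi>" "\<And>D. D \<in> A \<Longrightarrow> \<psi> \<turnstile>ec D"
  shows "\<exists>\<pi>'. prefix \<pi> \<pi>' \<and> ec_derivation \<psi> \<pi>' \<and> A \<subseteq> set \<pi>'"
  using assms(1,3)
proof (induction A rule: finite_induct)
  case empty
  then show ?case using assms(2) by auto
next
  case (insert D A)
  obtain \<pi>1 where 1: "prefix \<pi> \<pi>1" "ec_derivation \<psi> \<pi>1" "A \<subseteq> set \<pi>1"
    using insert by auto
  obtain \<pi>2 where 2: "ec_derivation \<psi> \<pi>2" "D \<in> set \<pi>2"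
    using insert.prems[of D] by (auto simp: ec_derives_def)
  have "prefix \<pi> (\<pi>1 @ \<pi>2)" "insert D A \<subseteq> set (\<pi>1 @ \<pi>2)"
    using 1 2 by auto
  then show ?case using ec_derivation_append[OF 1(2) 2(1)] by blast
qed

lemma ec_derives_mem: "D \<in> \<psi> \<Longrightarrow> \<psi> \<turnstile>ec D"
  unfolding ec_derives_def by (rule exI[of _ "[D]"]) (simp add: ec_derivation_def)

lemma ec_derives_rule:
  assumes "finite P" "ec_rule P D" "\<And>C. C \<in> P \<Longrightarrow> \<psi> \<turnstile>ec C"
  shows "\<psi> \<turnstile>ec D"
proof -
  \<comment> \<open>Starting from the empty derivation, the premises are collected in a single list
    to which \<open>D\<close> can be added.\<close>
  have "ec_derivation \<psi> []" by (simp add: ec_derivation_def)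
  then obtain \<pi> where \<pi>: "ec_derivation \<psi> \<pi>" "P \<subseteq> set \<pi>"
    using ec_derives_extension[OF assms(1)] assms(3) by meson
  have "ec_derivation \<psi> (\<pi> @ [D])"
    using \<pi> assms(2) by (intro ec_derivation_snoc) auto
  then show ?thesis unfolding ec_derives_def by (rule_tac x = "\<pi> @ [D]" in exI) simp
qed

text \<open>Inversion on the last step: the premises used for \<open>D\<close> occur earlier in the
  same derivation, which therefore also witnesses that they are derivable.\<close>

lemma ec_derives_cases:
  assumes "\<psi> \<turnstile>ec D"
  obtains "D \<in> \<psi>" | P where "ec_rule P D" "\<And>C. C \<in> P \<Longrightarrow> \<psi> \<turnstile>ec C"
proof -
  obtain \<pi> where \<pi>: "ec_derivation \<psi> \<pi>" "D \<in> set \<pi>"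
    using assms by (auto simp: ec_derives_def)
  then obtain j where j: "j < length \<pi>" "\<pi> ! j = D" by (auto simp: in_set_conv_nth)
  have "\<psi> \<turnstile>ec C" if "C \<in> set (take j \<pi>)" for C
    using \<pi>(1) in_set_takeD[OF that] by (auto simp: ec_derives_def)
  then show thesis using \<pi>(1) j that unfolding ec_derivation_def by (meson subsetD)
qed

section \<open>Conclusions of the EC rules, and clauses derivable over a 3-xor normal form\<close>

lemma ec_rule_card_le_2: "ec_rule P C \<Longrightarrow> card (fst C) \<le> 2"
  by (induction rule: ec_rule.induct) (auto simp: imply_inst_def)

text \<open>Every rule other than \<open>Unit3\<close> concludes a clause with at most one variable,
  and \<open>{u, v}\<close> has two since \<open>u \<noteq> v\<close>.\<close>

lemma ec_rule_binaryD:
  assumes "ec_rule P ({u, v}, q)" "u \<noteq> v"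
  obtains w a b where "distinct [w, u, v]" "P = {({w}, a), ({w, u, v}, b)}" "q = (a \<oplus> b)"
  using assms(1)
proof cases
  case (Unit3 w y z a b)
  \<comment> \<open>The pair \<open>{y, z}\<close> equals \<open>{u, v}\<close> in one of two
    orders; the ternary clause is the same in both.\<close>
  have "{w, y, z} = {w, u, v}" "distinct [w, u, v]"
    using Unit3 assms(2) by (auto simp: doubleton_eq_iff)
  then show thesis using Unit3 by (intro that[of w a b]) auto
qed (use assms(2) in \<open>auto simp: imply_inst_def doubleton_eq_iff\<close>)

context
  fixes \<phi> L :: "'v xclause set"
  assumes nf: "three_xor_nf \<phi>" and L: "L \<subseteq> xor_assumptions \<phi>"
begin

text \<open>An assumption literal has one variable and a rule conclusion at most two, so only
  \<open>\<phi>\<close> can supply a clause with three.\<close>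

lemma ec_derives_ternary_iff:
  assumes "card (fst D) = 3"
  shows "\<phi> \<union> L \<turnstile>ec D \<longleftrightarrow> D \<in> \<phi>"
proof
  assume "\<phi> \<union> L \<turnstile>ec D"
  then show "D \<in> \<phi>"
  proof (cases rule: ec_derives_cases)
    case 1
    then show ?thesis using L assms by (auto simp: xor_assumptions_def)
  next
    case 2
    then show ?thesis using ec_rule_card_le_2 assms by fastforce
  qed
qed (simp add: ec_derives_mem)

text \<open>Input clauses have three variables or one, so a binary clause must be the conclusion of
  a \<open>Unit3\<close> step, whose ternary premise lies in \<open>\<phi>\<close>. The converse
  carries out that step.\<close>

lemma ec_derives_binary_iff:
  assumes "u \<noteq> v"
  shows "\<phi> \<union> L \<turnstile>ec ({u, v}, q) \<longleftrightarrow>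
    (\<exists>w a b. distinct [u, v, w] \<and> ({u, v, w}, b) \<in> \<phi> \<and> \<phi> \<union> L \<turnstile>ec ({w}, a) \<and> q = (b \<oplus> a))"
    (is "?l \<longleftrightarrow> ?r")
proof
  assume ?l
  then show ?r
  proof (cases rule: ec_derives_cases)
    case 1
    have "card {u, v} = 2" using assms by simp
    then have "({u, v}, q) \<notin> \<phi>" using nf by (auto simp: three_xor_nf_def)
    moreover have "({u, v}, q) \<notin> L"
      using L assms by (auto simp: xor_assumptions_def doubleton_eq_iff)
    ultimately show ?thesis using 1 by simp
  next
    case (2 P)
    obtain w a b where w: "distinct [w, u, v]" "P = {({w}, a), ({w, u, v}, b)}" "q = (a \<oplus> b)"
      using ec_rule_binaryD[OF 2(1) assms] .
    \<comment> \<open>\<open>Unit3\<close> lists the eliminated variable first, whereas the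
      xor-cycle lists its outer variable last.\<close>
    have "{w, u, v} = {u, v, w}" by auto
    then have "\<phi> \<union> L \<turnstile>ec ({w}, a)" "\<phi> \<union> L \<turnstile>ec ({u, v, w}, b)"
      using 2(2) w(2) by auto
    moreover have "card (fst ({u, v, w}, b)) = 3" using w(1) by (auto simp: card_insert_if)
    ultimately have "({u, v, w}, b) \<in> \<phi>" using ec_derives_ternary_iff by blast
    moreover have "distinct [u, v, w]" "q = (b \<oplus> a)" using w by auto
    ultimately show ?thesis using \<open>\<phi> \<union> L \<turnstile>ec ({w}, a)\<close> by blast
  qed
next
  assume ?r
  then obtain w a b where "distinct [u, v, w]" "q = (b \<oplus> a)"
    and \<phi>w: "({u, v, w}, b) \<in> \<phi>" "\<phi> \<union> L \<turnstile>ec ({w}, a)" by blast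
  then have w: "distinct [w, u, v]" "q = (a \<oplus> b)" by auto
  have "{w, u, v} = {u, v, w}" by auto
  then have "\<phi> \<union> L \<turnstile>ec C" if "C \<in> {({w}, a), ({w, u, v}, b)}" for C
    using that \<phi>w by (auto intro: ec_derives_mem)
  moreover have "ec_rule {({w}, a), ({w, u, v}, b)} ({u, v}, q)"
    using Unit3[OF w(1)] w(2) by simp
  ultimately show ?l using ec_derives_rule[of "{({w}, a), ({w, u, v}, b)}"] by blast
qed

end

section \<open>Imply steps and xor-cycles\<close>

lemma finite_chain [simp]: "finite (chain n x c)"
proof -
  have "chain n x c = (\<lambda>i. ({x i, x (i + 1)}, c i)) ` {1..<n}" by (auto simp: chain_def)
  then show ?thesis by simp
qed

lemma bigxor_xor:
  "(\<And>i. 1 \<le> i \<Longrightarrow> i < Suc m \<Longrightarrow> c i = (p i \<oplus> q i)) \<Longrightarrow> bigxor c m = (bigxor p m \<oplus> bigxor q m)"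
  by (induction m) auto

text \<open>Adding \<open>p n\<close> completes the sum of \<open>p\<close>, while the sum of
  \<open>q\<close> stops at \<open>n - 1\<close>: the last outer variable is the one being derived
  and brings no unit value of its own.\<close>

lemma bigxor_xor_last:
  assumes "n \<ge> 1" "\<And>i. 1 \<le> i \<Longrightarrow> i < n \<Longrightarrow> c i = (p i \<oplus> q i)"
  shows "(bigxor c (n - 1) \<oplus> p n) = (bigxor p n \<oplus> bigxor q (n - 1))"
proof -
  \<comment> \<open>With \<open>n = Suc m\<close> the bound \<open>i < n\<close> takes the form
    required by \<open>bigxor_xor\<close>, and the last summand splits off.\<close>
  obtain m where n: "n = Suc m" using assms(1) by (metis Suc_pred' less_eq_Suc_le One_nat_def)
  have "bigxor c m = (bigxor p m \<oplus> bigxor q m)"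
    using assms(2) unfolding n by (rule bigxor_xor)
  then show ?thesis unfolding n bigxor.simps(2) diff_Suc_1 by argo
qed

text \<open>This eliminates \<open>\<pi>\<close>: derivations of the premises can be appended to any
  given derivation, so only the derivability of the premises matters.\<close>

lemma derived_by_imply_extension_iff:
  assumes "ec_derivation \<psi> \<pi>"
  shows "(\<exists>\<pi>'. prefix \<pi> \<pi>' \<and> ec_derivation \<psi> \<pi>' \<and> derived_by_imply \<pi>' n x c y d C) \<longleftrightarrow>
    (\<exists>P. imply_inst n x c y d P C \<and> (\<forall>D\<in>P. \<psi> \<turnstile>ec D))"
    (is "?l \<longleftrightarrow> ?r")
proof
  assume ?l
  then show ?r unfolding derived_by_imply_def ec_derives_def by (meson in_set_takeD subsetD)
next
  assume ?r
  then obtain P where P: "imply_inst n x c y d P C" "\<And>D. D \<in> P \<Longrightarrow> \<psi> \<turnstile>ec D" by blast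
  then have "finite P" by (simp add: imply_inst_def)
  then obtain \<pi>' where \<pi>': "prefix \<pi> \<pi>'" "ec_derivation \<psi> \<pi>'" "P \<subseteq> set \<pi>'"
    using ec_derives_extension[OF _ assms] P(2) by meson
  have "ec_derivation \<psi> (\<pi>' @ [C])"
    using \<pi>' ec_rule.Imply[OF P(1)] by (intro ec_derivation_snoc) auto
  \<comment> \<open>In the extended list \<open>C\<close> has index \<open>length \<pi>'\<close>, so
    all of \<open>\<pi>'\<close>, and with it \<open>P\<close>, precedes it.\<close>
  moreover have "derived_by_imply (\<pi>' @ [C]) n x c y d C"
    unfolding derived_by_imply_def using \<pi>'(3) P(1)
    by (intro exI[of _ "length \<pi>'"] conjI exI[of _ P]) auto
  ultimately show ?l using \<pi>'(1) by (meson prefix_prefix)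
qed

text \<open>The constants \<open>c i\<close> of an Imply step do not determine how they split into a
  cycle constant and a unit constant; hence the split is existentially chosen together with the
  cycle.\<close>

theorem lemma1:
  fixes \<phi> L \<psi> :: "'v xclause set" and \<pi> :: "'v xclause list"
    and n :: nat and x :: "nat \<Rightarrow> 'v" and c :: "nat \<Rightarrow> bool" and y :: 'v and d r :: bool
  assumes "finite \<phi>" and "three_xor_nf \<phi>"
    and "finite L" and "L \<subseteq> xor_assumptions \<phi>"
    and "\<psi> = \<phi> \<union> L" and "ec_derivation \<psi> \<pi>"
  shows "(\<exists>\<pi>'. prefix \<pi> \<pi>' \<and> ec_derivation \<psi> \<pi>' \<and> derived_by_imply \<pi>' n x c y d ({y}, r))
    \<longleftrightarrow>
    (\<exists>ys ps ps' p X.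
       (\<forall>i. 1 \<le> i \<and> i < n \<longrightarrow> c i = (ps i \<oplus> ps' i)) \<and> d = ps n \<and>
       r = (p \<oplus> bigxor ps' (n - 1)) \<and>
       ys n = y \<and> xor_cycle n x ys ps p X \<and> X \<subseteq> \<phi> \<and>
       (\<forall>i. 1 \<le> i \<and> i < n \<longrightarrow> \<psi> \<turnstile>ec ({ys i}, ps' i)))"
proof -
  note ternary = ec_derives_ternary_iff[OF assms(2,4), folded assms(5)]
  note binary = ec_derives_binary_iff[OF assms(2,4), folded assms(5)]
  show ?thesis unfolding derived_by_imply_extension_iff[OF assms(6)]
  proof
    assume "\<exists>P. imply_inst n x c y d P ({y}, r) \<and> (\<forall>D\<in>P. \<psi> \<turnstile>ec D)"
    then obtain P where P: "imply_inst n x c y d P ({y}, r)" "\<forall>D\<in>P. \<psi> \<turnstile>ec D" by blast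
    then have n: "n \<ge> 2" and ne: "\<And>i. 1 \<le> i \<Longrightarrow> i < n \<Longrightarrow> x i \<noteq> x (i + 1)"
      and dist: "distinct [x 1, x n, y]"
      and Peq: "P = chain n x c \<union> {({x 1, x n, y}, d)}"
      and r: "r = (bigxor c (n - 1) \<oplus> d)"
      by (auto simp: imply_inst_def)
    have "\<exists>w a b. distinct [x i, x (i + 1), w] \<and> ({x i, x (i + 1), w}, b) \<in> \<phi> \<and>
        \<psi> \<turnstile>ec ({w}, a) \<and> c i = (b \<oplus> a)" if "1 \<le> i" "i < n" for i
    proof -
      have "({x i, x (i + 1)}, c i) \<in> P" using that by (auto simp: Peq chain_def)
      then have "\<psi> \<turnstile>ec ({x i, x (i + 1)}, c i)" using P(2) by blast
      then show ?thesis using binary[OF ne[OF that]] by simp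
    qed
    \<comment> \<open>One choice per binary premise: \<open>w i\<close> becomes the outer variable,
      \<open>b i\<close> the constant of the cycle clause and \<open>a i\<close> that of the unit
      clause.\<close>
    then obtain w a b where w: "\<And>i. 1 \<le> i \<Longrightarrow> i < n \<Longrightarrow>
        distinct [x i, x (i + 1), w i] \<and> ({x i, x (i + 1), w i}, b i) \<in> \<phi> \<and>
        \<psi> \<turnstile>ec ({w i}, a i) \<and> c i = (b i \<oplus> a i)"
      by metis
    have last: "({x 1, x n, y}, d) \<in> \<phi>"
      using P(2) ternary[of "({x 1, x n, y}, d)"] dist by (simp add: Peq)
    \<comment> \<open>The choice fixes nothing at index \<open>n\<close>, where a cycle stores its
      closing clause, so \<open>y\<close> and \<open>d\<close> are placed there.\<close>
    define ys where "ys = w(n := y)"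
    define ps where "ps = b(n := d)"
    define X where "X = {({x i, x (i + 1), ys i}, ps i) | i. 1 \<le> i \<and> i < n}
      \<union> {({x 1, x n, ys n}, ps n)}"
    have c: "\<And>i. 1 \<le> i \<Longrightarrow> i < n \<Longrightarrow> c i = (ps i \<oplus> a i)"
      using w by (simp add: ps_def)
    have "(bigxor c (n - 1) \<oplus> ps n) = (bigxor ps n \<oplus> bigxor a (n - 1))"
      using n c by (intro bigxor_xor_last) auto
    then have "r = (bigxor ps n \<oplus> bigxor a (n - 1))"
      by (simp add: r ps_def)
    moreover have "xor_cycle n x ys ps (bigxor ps n) X"
      using n dist w by (auto simp: xor_cycle_def X_def ys_def)
    moreover have "X \<subseteq> \<phi>"
      using w last by (auto simp: X_def ys_def ps_def)
    moreover have "\<forall>i. 1 \<le> i \<and> i < n \<longrightarrow> \<psi> \<turnstile>ec ({ys i}, a i)"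
      using w by (simp add: ys_def)
    moreover have "ys n = y" "d = ps n" by (simp_all add: ys_def ps_def)
    ultimately show "\<exists>ys ps ps' p X.
       (\<forall>i. 1 \<le> i \<and> i < n \<longrightarrow> c i = (ps i \<oplus> ps' i)) \<and> d = ps n \<and>
       r = (p \<oplus> bigxor ps' (n - 1)) \<and>
       ys n = y \<and> xor_cycle n x ys ps p X \<and> X \<subseteq> \<phi> \<and>
       (\<forall>i. 1 \<le> i \<and> i < n \<longrightarrow> \<psi> \<turnstile>ec ({ys i}, ps' i))"
      using c by (intro exI[of _ ys] exI[of _ ps] exI[of _ a] exI[of _ "bigxor ps n"] exI[of _ X]) simp
  next
    assume "\<exists>ys ps ps' p X.
       (\<forall>i. 1 \<le> i \<and> i < n \<longrightarrow> c i = (ps i \<oplus> ps' i)) \<and> d = ps n \<and>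
       r = (p \<oplus> bigxor ps' (n - 1)) \<and>
       ys n = y \<and> xor_cycle n x ys ps p X \<and> X \<subseteq> \<phi> \<and>
       (\<forall>i. 1 \<le> i \<and> i < n \<longrightarrow> \<psi> \<turnstile>ec ({ys i}, ps' i))"
    then obtain ys ps ps' p X where
      c: "\<And>i. 1 \<le> i \<Longrightarrow> i < n \<Longrightarrow> c i = (ps i \<oplus> ps' i)" and d: "d = ps n"
      and r: "r = (p \<oplus> bigxor ps' (n - 1))" and y: "ys n = y"
      and cyc: "xor_cycle n x ys ps p X" and X: "X \<subseteq> \<phi>"
      and ys: "\<And>i. 1 \<le> i \<Longrightarrow> i < n \<Longrightarrow> \<psi> \<turnstile>ec ({ys i}, ps' i)"
      by blast
    have n: "n \<ge> 2" and dist: "\<And>i. 1 \<le> i \<Longrightarrow> i < n \<Longrightarrow> distinct [x i, x (i + 1), ys i]"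
      and dist_last: "distinct [x 1, x n, y]" and p: "p = bigxor ps n"
      and Xeq: "X = {({x i, x (i + 1), ys i}, ps i) | i. 1 \<le> i \<and> i < n} \<union> {({x 1, x n, y}, d)}"
      using cyc y d by (auto simp: xor_cycle_def)
    \<comment> \<open>Eliminating \<open>ys i\<close> from the \<open>i\<close>-th cycle clause by
      its unit clause yields the \<open>i\<close>-th premise of the chain.\<close>
    have "\<psi> \<turnstile>ec ({x i, x (i + 1)}, c i)" if "1 \<le> i" "i < n" for i
    proof -
      have "x i \<noteq> x (i + 1)" "({x i, x (i + 1), ys i}, ps i) \<in> \<phi>"
        using dist[OF that] X that by (auto simp: Xeq)
      then show ?thesis unfolding binary[OF \<open>x i \<noteq> x (i + 1)\<close>]
        using dist[OF that] ys[OF that] c[OF that]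
        by (intro exI[of _ "ys i"] exI[of _ "ps' i"] exI[of _ "ps i"]) simp
    qed
    moreover have "\<psi> \<turnstile>ec ({x 1, x n, y}, d)"
      using X assms(5) by (intro ec_derives_mem) (auto simp: Xeq)
    ultimately have "\<forall>D \<in> chain n x c \<union> {({x 1, x n, y}, d)}. \<psi> \<turnstile>ec D"
      by (auto simp: chain_def)
    moreover have "imply_inst n x c y d (chain n x c \<union> {({x 1, x n, y}, d)}) ({y}, r)"
      unfolding imply_inst_def
    proof (intro conjI)
      have "(bigxor c (n - 1) \<oplus> ps n) = (bigxor ps n \<oplus> bigxor ps' (n - 1))"
        using n c by (intro bigxor_xor_last) auto
      then show "({y}, r) = ({y}, bigxor c (n - 1) \<oplus> d)" by (simp add: r p d)
    qed (use n dist dist_last in auto)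
    ultimately show "\<exists>P. imply_inst n x c y d P ({y}, r) \<and> (\<forall>D\<in>P. \<psi> \<turnstile>ec D)" by blast
  qed
qed

end
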